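(* Let $G$ be a strongly topological gyrogroup and let $H$ be a closed neutral strong subgyrogroup of $G$. Then $G/H$ is metrizable if and only if $G/H$ is a biradial space with countable pseudocharacter.
   Context: A gyrogroup is a nonempty set $G$ with a binary operation $\oplus$ such that: (G1) there is $0\in G$ with $0\oplus x=x=x\oplus 0$ for all $x\in G$; (G2) each $x\in G$ has an inverse $\ominus x\in G$ with $\ominus x\oplus x=0=x\oplus(\ominus x)$; (G3) for all $x,y\in G$ there is an automorphism $\mathrm{gyr}[x,y]$ of $(G,\oplus)$ (a bijection preserving $\oplus$) with $x\oplus(y\oplus z)=(x\oplus y)\oplus \mathrm{gyr}[x,y](z)$ for all $z\in G$; (G4) $\mathrm{gyr}[x\oplus y,y]=\mathrm{gyr}[x,y]$ for all $x,y\in G$. For $A,B\subseteq G$, $A\oplus B=\{a\oplus b:a\in A,b\in B\}$ and $\ominus A=\{\ominus a:a\in A\}$. A subset $A\subseteq G$ is gyr-invariant if $\mathrm{gyr}[x,y](A)=A$ for all $x,y\in G$. A subgyrogroup is a nonempty $H\subseteq G$ closed under $\oplus$ and $\ominus$; it is strong if it is gyr-invariant. A topological gyrogroup is a gyrogroup with a topology for which $\oplus:G\times G\to G$ and $\ominus:G\to G$ are continuous; it is strongly topological if every neighborhood of $0$ contains a gyr-invariant neighborhood of $0$. A subgyrogroup $H$ is neutral if for every neighborhood $U$ of $0$ there are open neighborhoods $V,V'$ of $0$ with $H\oplus V\subseteq U\oplus H$ and $V'\oplus H\subseteq H\oplus U$. For a strong subgyrogroup $H$, $G/H=\{a\oplus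 H:a\in G\}$ is a partition of $G$ and carries the quotient topology of the map $a\mapsto a\oplus H$. No separation axiom is assumed unless stated. Let $X$ be a space. A prefilter on $X$ is a family $\zeta$ of nonempty subsets of $X$ such that for $P_1,P_2\in\zeta$ there is $P\in\zeta$ with $P\subseteq P_1\cap P_2$. A prefilter converges to $x\in X$ if every open neighborhood of $x$ contains an element of it. Two prefilters $\zeta,\eta$ are synchronous if $P\cap Q\ne\emptyset$ for all $P\in\zeta$, $Q\in\eta$. $X$ is biradial if for every prefilter $\zeta$ on $X$ converging to a point $x\in X$ there is a chain $\eta$ (with respect to inclusion) of nonempty subsets of $X$ converging to $x$ and synchronous with $\zeta$. $X$ has countable pseudocharacter if $\{x\}$ is a $G_\delta$-subset of $X$ for each $x\in X$. *)

theory Defs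
  imports "HOL-Analysis.Analysis"
begin

section \<open>Gyrogroups\<close>

record 'a gyrostructure =
  gcarrier :: "'a set"
  gadd :: "'a \<Rightarrow> 'a \<Rightarrow> 'a"
  gzero :: 'a
  gneg :: "'a \<Rightarrow> 'a"
  gyr :: "'a \<Rightarrow> 'a \<Rightarrow> 'a \<Rightarrow> 'a"

text \<open>
  The identity, the inverses and the gyrations are components of the structure. On the carrier
  they are determined by the operation, so this is only a choice of names for the objects whose
  existence the axioms assert. Nothing is required of the components outside the carrier.
\<close>

definition gyro_automorphism :: "('a, 'm) gyrostructure_scheme \<Rightarrow> ('a \<Rightarrow> 'a) \<Rightarrow> bool" where
  "gyro_automorphism G f \<longleftrightarrow> bij_betw f (gcarrier G) (gcarrier G) \<and>
     (\<forall>x\<in>gcarrier G. \<forall>y\<in>gcarrier G. f (gadd G x y) = gadd G (f x) (f y))"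

locale gyrogroup =
  fixes G :: "('a, 'm) gyrostructure_scheme" (structure)
  assumes add_closed: "\<lbrakk>x \<in> gcarrier G; y \<in> gcarrier G\<rbrakk> \<Longrightarrow> gadd G x y \<in> gcarrier G"
    and zero_closed: "gzero G \<in> gcarrier G"
    and zero_left: "x \<in> gcarrier G \<Longrightarrow> gadd G (gzero G) x = x"
    and zero_right: "x \<in> gcarrier G \<Longrightarrow> gadd G x (gzero G) = x"
    and neg_closed: "x \<in> gcarrier G \<Longrightarrow> gneg G x \<in> gcarrier G"
    and neg_left: "x \<in> gcarrier G \<Longrightarrow> gadd G (gneg G x) x = gzero G"
    and neg_right: "x \<in> gcarrier G \<Longrightarrow> gadd G x (gneg G x) = gzero G"
    and gyr_automorphism:
      "\<lbrakk>x \<in> gcarrier G; y \<in> gcarrier G\<rbrakk> \<Longrightarrow> gyro_automorphism G (gyr G x y)"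
    and left_gyroassociative:
      "\<lbrakk>x \<in> gcarrier G; y \<in> gcarrier G; z \<in> gcarrier G\<rbrakk> \<Longrightarrow>
        gadd G x (gadd G y z) = gadd G (gadd G x y) (gyr G x y z)"
    and left_loop:
      "\<lbrakk>x \<in> gcarrier G; y \<in> gcarrier G; z \<in> gcarrier G\<rbrakk> \<Longrightarrow>
        gyr G (gadd G x y) y z = gyr G x y z"

definition gset_add :: "('a, 'm) gyrostructure_scheme \<Rightarrow> 'a set \<Rightarrow> 'a set \<Rightarrow> 'a set" where
  "gset_add G A B = {gadd G a b | a b. a \<in> A \<and> b \<in> B}"

definition gyr_invariant :: "('a, 'm) gyrostructure_scheme \<Rightarrow> 'a set \<Rightarrow> bool" where
  "gyr_invariant G A \<longleftrightarrow> A \<subseteq> gcarrier G \<and>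
     (\<forall>x\<in>gcarrier G. \<forall>y\<in>gcarrier G. gyr G x y ` A = A)"

definition subgyrogroup :: "('a, 'm) gyrostructure_scheme \<Rightarrow> 'a set \<Rightarrow> bool" where
  "subgyrogroup G H \<longleftrightarrow> H \<subseteq> gcarrier G \<and> H \<noteq> {} \<and>
     (\<forall>x\<in>H. \<forall>y\<in>H. gadd G x y \<in> H) \<and> (\<forall>x\<in>H. gneg G x \<in> H)"

definition strong_subgyrogroup :: "('a, 'm) gyrostructure_scheme \<Rightarrow> 'a set \<Rightarrow> bool" where
  "strong_subgyrogroup G H \<longleftrightarrow> subgyrogroup G H \<and> gyr_invariant G H"

section \<open>Topological gyrogroups\<close>

definition neighbourhood_in :: "'a topology \<Rightarrow> 'a \<Rightarrow> 'a set \<Rightarrow> bool" where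
  "neighbourhood_in X x N \<longleftrightarrow> N \<subseteq> topspace X \<and> (\<exists>U. openin X U \<and> x \<in> U \<and> U \<subseteq> N)"

locale topological_gyrogroup = gyrogroup G
  for G :: "('a, 'm) gyrostructure_scheme" (structure) +
  fixes T :: "'a topology"
  assumes topspace_eq: "topspace T = gcarrier G"
    and continuous_add: "continuous_map (prod_topology T T) T (\<lambda>(x, y). gadd G x y)"
    and continuous_neg: "continuous_map T T (gneg G)"

locale strongly_topological_gyrogroup = topological_gyrogroup G T
  for G :: "('a, 'm) gyrostructure_scheme" (structure) and T :: "'a topology" +
  assumes gyr_invariant_neighbourhoods:
    "neighbourhood_in T (gzero G) U \<Longrightarrow>
      \<exists>V. neighbourhood_in T (gzero G) V \<and> gyr_invariant G V \<and> V \<subseteq> U"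

definition neutral_in :: "('a, 'm) gyrostructure_scheme \<Rightarrow> 'a topology \<Rightarrow> 'a set \<Rightarrow> bool" where
  "neutral_in G T H \<longleftrightarrow>
     (\<forall>U. neighbourhood_in T (gzero G) U \<longrightarrow>
       (\<exists>V V'. openin T V \<and> gzero G \<in> V \<and> openin T V' \<and> gzero G \<in> V' \<and>
          gset_add G H V \<subseteq> gset_add G U H \<and> gset_add G V' H \<subseteq> gset_add G H U))"

section \<open>Quotient spaces\<close>

definition quotient_topology :: "'a topology \<Rightarrow> ('a \<Rightarrow> 'b) \<Rightarrow> 'b topology" where
  "quotient_topology X f =
     topology (\<lambda>U. U \<subseteq> f ` topspace X \<and> openin X {x \<in> topspace X. f x \<in> U})"

lemma openin_quotient_topology:
  "openin (quotient_topology X f) U \<longleftrightarrow>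
     U \<subseteq> f ` topspace X \<and> openin X {x \<in> topspace X. f x \<in> U}"
proof -
  let ?P = "\<lambda>U. U \<subseteq> f ` topspace X \<and> openin X {x \<in> topspace X. f x \<in> U}"
  have "istopology ?P"
    unfolding istopology_def
  proof (intro conjI allI impI)
    fix S T assume "?P S" "?P T"
    moreover have "{x \<in> topspace X. f x \<in> S \<inter> T} =
        {x \<in> topspace X. f x \<in> S} \<inter> {x \<in> topspace X. f x \<in> T}" by auto
    ultimately show "S \<inter> T \<subseteq> f ` topspace X" "openin X {x \<in> topspace X. f x \<in> S \<inter> T}"
      by auto
  next
    fix K assume K: "\<forall>S\<in>K. ?P S"
    then show "\<Union>K \<subseteq> f ` topspace X" by blast
    have "{x \<in> topspace X. f x \<in> \<Union>K} = (\<Union>S\<in>K. {x \<in> topspace X. f x \<in> S})" by auto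
    with K show "openin X {x \<in> topspace X. f x \<in> \<Union>K}" by auto
  qed
  then show ?thesis
    by (simp add: quotient_topology_def)
qed

lemma topspace_quotient_topology: "topspace (quotient_topology X f) = f ` topspace X"
proof -
  have "{x \<in> topspace X. f x \<in> f ` topspace X} = topspace X" by auto
  then have "openin (quotient_topology X f) (f ` topspace X)"
    by (simp add: openin_quotient_topology)
  then show ?thesis
    by (meson openin_quotient_topology openin_subset openin_topspace subset_antisym)
qed

lemma quotient_map_quotient_topology: "quotient_map X (quotient_topology X f) f"
  by (simp add: quotient_map_def topspace_quotient_topology openin_quotient_topology)

definition left_coset :: "('a, 'm) gyrostructure_scheme \<Rightarrow> 'a set \<Rightarrow> 'a \<Rightarrow> 'a set" where
  "left_coset G H a = gset_add G {a} H"

definition coset_space ::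
    "('a, 'm) gyrostructure_scheme \<Rightarrow> 'a topology \<Rightarrow> 'a set \<Rightarrow> 'a set topology" where
  "coset_space G T H = quotient_topology T (left_coset G H)"

section \<open>Biradial spaces and pseudocharacter\<close>

definition prefilter_on :: "'a topology \<Rightarrow> 'a set set \<Rightarrow> bool" where
  "prefilter_on X \<zeta> \<longleftrightarrow> (\<forall>P\<in>\<zeta>. P \<noteq> {} \<and> P \<subseteq> topspace X) \<and>
     (\<forall>P1\<in>\<zeta>. \<forall>P2\<in>\<zeta>. \<exists>P\<in>\<zeta>. P \<subseteq> P1 \<inter> P2)"

definition family_converges :: "'a topology \<Rightarrow> 'a set set \<Rightarrow> 'a \<Rightarrow> bool" where
  "family_converges X \<zeta> x \<longleftrightarrow> (\<forall>U. openin X U \<and> x \<in> U \<longrightarrow> (\<exists>P\<in>\<zeta>. P \<subseteq> U))"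

definition synchronous :: "'a set set \<Rightarrow> 'a set set \<Rightarrow> bool" where
  "synchronous \<zeta> \<eta> \<longleftrightarrow> (\<forall>P\<in>\<zeta>. \<forall>Q\<in>\<eta>. P \<inter> Q \<noteq> {})"

definition biradial_space :: "'a topology \<Rightarrow> bool" where
  "biradial_space X \<longleftrightarrow>
     (\<forall>\<zeta> x. prefilter_on X \<zeta> \<and> x \<in> topspace X \<and> family_converges X \<zeta> x \<longrightarrow>
       (\<exists>\<eta>. chain\<^sub>\<subseteq> \<eta> \<and> (\<forall>Q\<in>\<eta>. Q \<noteq> {} \<and> Q \<subseteq> topspace X) \<and>
          family_converges X \<eta> x \<and> synchronous \<zeta> \<eta>))"

definition countable_pseudocharacter :: "'a topology \<Rightarrow> bool" where
  "countable_pseudocharacter X \<longleftrightarrow> (\<forall>x\<in>topspace X. gdelta_in X {x})"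

end

theory Submission
  imports Defs
begin

text \<open>
  A metrizable space is biradial because the balls around a point form a chain, and its points are
  \<open>G\<^sub>\<delta>\<close> sets because they are closed. The other implication rests on two ideas.

  The first is that the cosets carry a left-invariant uniformity. Two elements of a gyrogroup are
  called near with respect to a set \<open>A\<close> if they differ on the right by an element of \<open>A\<close>
  (\<open>near\<close>). For gyr-invariant \<open>A\<close> the gyrations disappear from the calculus of these relations:
  they are preserved by left translations and compose like sums of sets (\<open>near_trans\<close>,
  \<open>near_split\<close>). Strongly topological gyrogroups have enough gyr-invariant neighbourhoods of
  \<open>0\<close>, and for such a neighbourhood \<open>V\<close> the image of the relation on the coset space is
  \<open>cnear V\<close>. Neutrality makes these images the entourages of a uniformity
  (\<open>cnear_compose\<close>) which induces the quotient topology (\<open>cnear_nbhd\<close>,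
  \<open>cnear_base\<close>). By Frink's chain argument a countable base of entourages and the
  \<open>T\<^sub>1\<close> axiom, which follows from countable pseudocharacter, give a metric
  (\<open>metrizable_from_countable_entourages\<close>).

  The second idea produces the countable base. Biradiality is applied to the prefilter of
  all sets \<open>U \<inter> D\<close> with \<open>U\<close> an open neighbourhood of the coset \<open>H\<close> and \<open>D\<close> open and dense.
  A chain synchronous with it consists of sets that are not nowhere dense, and since \<open>{H}\<close> is a
  \<open>G\<^sub>\<delta>\<close> set, countably many of them, or \<open>{H}\<close> alone, already converge to \<open>H\<close>
  (\<open>biradial_gdelta_somewhere_dense_sequence\<close>). The closure of each of these sets \<open>Q n\<close> contains
  a translate of a neighbourhood \<open>U n\<close>; when \<open>Q n\<close> is small so is its closure, hence so is the
  translate, and left-invariance shows that the entourages of the \<open>U n\<close> form a base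
  (\<open>cnear_countable_base\<close>). This is the analogue of the fact that in a group \<open>Q\<^sup>-\<^sup>1 Q\<close>
  is a neighbourhood of the identity when \<open>Q\<close> has interior.
\<close>

section \<open>Metrization from a countable base of entourages\<close>

text \<open>
  This is Frink's chain argument. In a chain of total length \<open>S\<close>, cut at the first edge by whose
  end at least \<open>S / 2\<close> has been used up: the parts before and after that edge have length at most
  \<open>S / 2\<close>, so the induction hypothesis bounds the gap of each by \<open>S\<close>, and the edge itself is at
  most \<open>S\<close>. The weak triangle inequality for three steps then loses the factor 2 only once.
\<close>

lemma chain_length_lower_bound:
  fixes f :: "'b \<Rightarrow> 'b \<Rightarrow> real"
  assumes nonneg: "\<And>x y. 0 \<le> f x y"
    and zero: "\<And>x. x \<in> M \<Longrightarrow> f x x = 0"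
    and weak: "\<And>x y z w c. \<lbrakk>x \<in> M; y \<in> M; z \<in> M; w \<in> M; f x y \<le> c; f y z \<le> c; f z w \<le> c\<rbrakk>
      \<Longrightarrow> f x w \<le> 2 * c"
  shows "(\<And>i. i \<le> n \<Longrightarrow> p i \<in> M) \<Longrightarrow> f (p 0) (p n) \<le> 2 * (\<Sum>i<n. f (p i) (p (Suc i)))"
proof (induction n arbitrary: p rule: less_induct)
  case (less n)
  show ?case
  proof (cases "n = 0")
    case True
    then show ?thesis using zero less.prems by simp
  next
    case False
    define s where "s k = (\<Sum>i<k. f (p i) (p (Suc i)))" for k
    have s_mono: "s k \<le> s l" if "k \<le> l" for k l
      unfolding s_def using that nonneg by (intro sum_mono2) auto
    have s_nonneg: "0 \<le> s k" for k
      unfolding s_def by (intro sum_nonneg nonneg)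
    define k where "k = (LEAST k. s n / 2 \<le> s (Suc k))"
    have ex: "s n / 2 \<le> s (Suc (n - 1))" using False s_nonneg[of n] by simp
    then have upper: "s n / 2 \<le> s (Suc k)" unfolding k_def by (rule LeastI)
    have "k \<le> n - 1" unfolding k_def using ex by (rule Least_le)
    with False have "k < n" by simp
    have lower: "s k \<le> s n / 2"
    proof (cases k)
      case 0
      then show ?thesis using s_nonneg[of n] by (simp add: s_def)
    next
      case (Suc j)
      then have "\<not> s n / 2 \<le> s (Suc j)"
        using not_less_Least[of j "\<lambda>k. s n / 2 \<le> s (Suc k)"] unfolding k_def by auto
      with Suc show ?thesis by simp
    qed
    let ?q = "\<lambda>i. p (Suc k + i)"
    have tail: "s n = s (Suc k) + (\<Sum>i<n - Suc k. f (?q i) (?q (Suc i)))"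
    proof -
      have "s n = s (Suc k) + (\<Sum>i=Suc k..<n. f (p i) (p (Suc i)))"
        unfolding s_def lessThan_atLeast0
        using \<open>k < n\<close> by (intro sum.atLeastLessThan_concat[symmetric]) auto
      also have "(\<Sum>i=Suc k..<n. f (p i) (p (Suc i))) = (\<Sum>i<n - Suc k. f (?q i) (?q (Suc i)))"
        using \<open>k < n\<close> by (intro sum.reindex_bij_witness[of _ "\<lambda>i. Suc k + i" "\<lambda>i. i - Suc k"]) auto
      finally show ?thesis .
    qed
    have "f (p 0) (p k) \<le> 2 * s k"
      unfolding s_def using \<open>k < n\<close> less.prems by (intro less.IH) auto
    then have 1: "f (p 0) (p k) \<le> s n" using lower by linarith
    have 2: "f (p k) (p (Suc k)) \<le> s n"
      using s_mono[of "Suc k" n] \<open>k < n\<close> s_nonneg[of k] by (simp add: s_def)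
    have "f (?q 0) (?q (n - Suc k)) \<le> 2 * (\<Sum>i<n - Suc k. f (?q i) (?q (Suc i)))"
      using \<open>k < n\<close> less.prems by (intro less.IH) auto
    then have 3: "f (p (Suc k)) (p n) \<le> s n" using tail upper \<open>k < n\<close> by simp
    show ?thesis
      using weak[OF _ _ _ _ 1 2 3] less.prems \<open>k < n\<close> unfolding s_def by simp
  qed
qed

text \<open>
  The chain infimum turns a gauge with the weak triangle inequality into a metric without
  changing its size by more than a factor 2.
\<close>

lemma metric_from_gauge:
  fixes f :: "'b \<Rightarrow> 'b \<Rightarrow> real"
  assumes nonneg: "\<And>x y. 0 \<le> f x y"
    and zero: "\<And>x y. \<lbrakk>x \<in> M; y \<in> M\<rbrakk> \<Longrightarrow> f x y = 0 \<longleftrightarrow> x = y"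
    and sym: "\<And>x y. f x y = f y x"
    and weak: "\<And>x y z w c. \<lbrakk>x \<in> M; y \<in> M; z \<in> M; w \<in> M; f x y \<le> c; f y z \<le> c; f z w \<le> c\<rbrakk>
      \<Longrightarrow> f x w \<le> 2 * c"
  shows "\<exists>d. Metric_space M d \<and> (\<forall>x\<in>M. \<forall>y\<in>M. d x y \<le> f x y \<and> f x y \<le> 2 * d x y)"
proof -
  define L where "L x y = {(\<Sum>i<n. f (p i) (p (Suc i))) | n p. p 0 = x \<and> p n = y \<and> (\<forall>i\<le>n. p i \<in> M)}"
    for x y
  define d where "d x y = (if x \<in> M \<and> y \<in> M then Inf (L x y) else 0)" for x y
  have edge: "f x y \<in> L x y" if "x \<in> M" "y \<in> M" for x y
    unfolding L_def using that
    by (intro CollectI exI[of _ 1] exI[of _ "\<lambda>i. if i = 0 then x else y"]) auto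
  have L_nonneg: "0 \<le> l" if "l \<in> L x y" for l x y
    using that nonneg unfolding L_def by (auto intro: sum_nonneg)
  have bdd: "bdd_below (L x y)" for x y
    using L_nonneg by (meson bdd_belowI)
  have L_lower: "f x y \<le> 2 * l" if "l \<in> L x y" for l x y
  proof -
    from that obtain n p where l: "l = (\<Sum>i<n. f (p i) (p (Suc i)))"
      and p: "p 0 = x" "p n = y" "\<forall>i\<le>n. p i \<in> M"
      unfolding L_def by blast
    have "f (p 0) (p n) \<le> 2 * (\<Sum>i<n. f (p i) (p (Suc i)))"
      by (rule chain_length_lower_bound[where M = M]) (use nonneg zero weak p in auto)
    with l p show ?thesis by simp
  qed
  have L_rev: "L x y \<subseteq> L y x" for x y
  proof
    fix l assume "l \<in> L x y"
    then obtain n p where l: "l = (\<Sum>i<n. f (p i) (p (Suc i)))"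
      and p: "p 0 = x" "p n = y" "\<forall>i\<le>n. p i \<in> M"
      unfolding L_def by blast
    have "l = (\<Sum>i<n. f (p (n - i)) (p (n - Suc i)))"
      unfolding l
    proof (rule sum.reindex_bij_witness[of _ "\<lambda>i. n - Suc i" "\<lambda>i. n - Suc i"])
      fix i assume "i \<in> {..<n}"
      then have "n - (n - Suc i) = Suc i" "n - Suc (n - Suc i) = i" by auto
      then show "f (p (n - (n - Suc i))) (p (n - Suc (n - Suc i))) = f (p i) (p (Suc i))"
        using sym by simp
    qed auto
    then show "l \<in> L y x"
      unfolding L_def using p by (intro CollectI exI[of _ n] exI[of _ "\<lambda>i. p (n - i)"]) auto
  qed
  have L_concat: "k + l \<in> L x z" if k: "k \<in> L x y" and l: "l \<in> L y z" for k l x y z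
  proof -
    from k obtain m p where k: "k = (\<Sum>i<m. f (p i) (p (Suc i)))"
      and p: "p 0 = x" "p m = y" "\<forall>i\<le>m. p i \<in> M"
      unfolding L_def by blast
    from l obtain n q where l: "l = (\<Sum>i<n. f (q i) (q (Suc i)))"
      and q: "q 0 = y" "q n = z" "\<forall>i\<le>n. q i \<in> M"
      unfolding L_def by blast
    define r where "r i = (if i < m then p i else q (i - m))" for i
    have "(\<Sum>i<m + n. f (r i) (r (Suc i))) =
        (\<Sum>i<m. f (r i) (r (Suc i))) + (\<Sum>i<n. f (r (m + i)) (r (Suc (m + i))))"
      by (induction n) (simp_all add: add.assoc)
    also have "(\<Sum>i<m. f (r i) (r (Suc i))) = k"
    proof -
      have "r (Suc i) = p (Suc i)" if "i < m" for i
        using that p q by (cases "Suc i = m") (auto simp: r_def)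
      then show ?thesis unfolding k by (intro sum.cong) (auto simp: r_def)
    qed
    also have "(\<Sum>i<n. f (r (m + i)) (r (Suc (m + i)))) = l"
      unfolding l by (intro sum.cong) (auto simp: r_def Suc_diff_le)
    finally have "k + l = (\<Sum>i<m + n. f (r i) (r (Suc i)))" by simp
    moreover have "r 0 = x" "r (m + n) = z" "\<forall>i\<le>m + n. r i \<in> M"
      using p q by (cases "m = 0"; auto simp: r_def)+
    ultimately show ?thesis unfolding L_def by blast
  qed
  have upper: "d x y \<le> f x y" if "x \<in> M" "y \<in> M" for x y
    using that cInf_lower[OF edge bdd] by (simp add: d_def)
  have lower: "f x y \<le> 2 * d x y" if "x \<in> M" "y \<in> M" for x y
  proof -
    have "f x y / 2 \<le> Inf (L x y)"
    proof (rule cInf_greatest)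
      show "L x y \<noteq> {}" using edge that by blast
      show "f x y / 2 \<le> l" if "l \<in> L x y" for l using L_lower[OF that] by simp
    qed
    with that show ?thesis by (simp add: d_def)
  qed
  have "Metric_space M d"
  proof
    show "0 \<le> d x y" for x y
      unfolding d_def using edge[of x y] L_nonneg by (cases "L x y = {}") (auto intro!: cInf_greatest)
    show "d x y = d y x" for x y
      using L_rev[of x y] L_rev[of y x] by (simp add: d_def)
    show "d x y = 0 \<longleftrightarrow> x = y" if "x \<in> M" "y \<in> M" for x y
    proof
      assume "d x y = 0"
      then have "f x y = 0" using lower[OF that] nonneg[of x y] by simp
      then show "x = y" using zero that by simp
    next
      assume "x = y"
      then show "d x y = 0"
        using upper[OF that] lower[OF that] zero[OF that] by simp
    qed
    show "d x z \<le> d x y + d y z" if "x \<in> M" "y \<in> M" "z \<in> M" for x y z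
    proof -
      have "Inf (L x z) - l \<le> k" if "k \<in> L x y" "l \<in> L y z" for k l
        using cInf_lower[OF L_concat[OF that] bdd] by simp
      then have "Inf (L x z) - l \<le> Inf (L x y)" if "l \<in> L y z" for l
        using that edge[OF \<open>x \<in> M\<close> \<open>y \<in> M\<close>] by (intro cInf_greatest) auto
      then have "Inf (L x z) - Inf (L x y) \<le> l" if "l \<in> L y z" for l
        using that by (simp add: algebra_simps)
      then have "Inf (L x z) - Inf (L x y) \<le> Inf (L y z)"
        using edge[OF \<open>y \<in> M\<close> \<open>z \<in> M\<close>] by (intro cInf_greatest) auto
      then show ?thesis using that by (simp add: d_def)
    qed
  qed
  then show ?thesis using upper lower by (intro exI[of _ d]) simp
qed

text \<open>
  With the gauge \<open>(1 / 2) ^ k\<close>, where \<open>k\<close> is the number of the first entourage that misses the pair, the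
  condition on triple composites is the weak triangle inequality of Frink's argument.
\<close>

lemma metrizable_from_countable_entourages:
  fixes E :: "nat \<Rightarrow> 'b \<Rightarrow> 'b \<Rightarrow> bool"
  assumes t1: "t1_space X"
    and refl: "\<And>n x. x \<in> topspace X \<Longrightarrow> E n x x"
    and sym: "\<And>n x y. E n x y \<Longrightarrow> E n y x"
    and triple: "\<And>n x y z w. \<lbrakk>E (Suc n) x y; E (Suc n) y z; E (Suc n) z w\<rbrakk> \<Longrightarrow> E n x w"
    and nhd: "\<And>n x. x \<in> topspace X \<Longrightarrow> \<exists>U. openin X U \<and> x \<in> U \<and> (\<forall>y\<in>U. E n x y)"
    and base: "\<And>U x. \<lbrakk>openin X U; x \<in> U\<rbrakk> \<Longrightarrow> \<exists>n. \<forall>y\<in>topspace X. E n x y \<longrightarrow> y \<in> U"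
  shows "metrizable_space X"
proof -
  define M where "M = topspace X"
  define f :: "'b \<Rightarrow> 'b \<Rightarrow> real"
    where "f x y = (if \<forall>n. E n x y then 0 else (1 / 2) ^ (LEAST n. \<not> E n x y))" for x y
  have step1: "E n x y" if "E (Suc n) x y" "x \<in> M" "y \<in> M" for n x y
    using triple[OF refl that(1) refl] that(2,3) by (simp add: M_def)
  have down: "E m x y" if "E n x y" "m \<le> n" "x \<in> M" "y \<in> M" for m n x y
    using that(2)
  proof (induction rule: inc_induct)
    case base
    show ?case by (rule that(1))
  next
    case (step i)
    from step.IH that(3,4) show ?case by (rule step1)
  qed
  have f_less_iff: "f x y < (1 / 2) ^ n \<longleftrightarrow> E n x y" if xy: "x \<in> M" "y \<in> M" for x y n
  proof (cases "\<forall>n. E n x y")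
    case True
    then show ?thesis by (simp add: f_def)
  next
    case False
    define k where "k = (LEAST n. \<not> E n x y)"
    have "\<not> E k x y" using LeastI_ex[of "\<lambda>n. \<not> E n x y"] False unfolding k_def by simp
    moreover have "E n x y" if "n < k" for n
      using that not_less_Least[of n "\<lambda>n. \<not> E n x y"] unfolding k_def by simp
    ultimately have "E n x y \<longleftrightarrow> n < k" using down[OF _ _ xy, of k n] down[OF _ _ xy, of n k]
      by (meson not_le)
    moreover have "f x y = (1 / 2) ^ k" using False by (simp add: f_def k_def)
    ultimately show ?thesis by simp
  qed
  have f_zero_iff: "f x y = 0 \<longleftrightarrow> (\<forall>n. E n x y)" for x y by (simp add: f_def)
  have nonneg: "0 \<le> f x y" for x y by (simp add: f_def)
  have separated: "x = y" if E: "\<And>n. E n x y" and xy: "x \<in> M" "y \<in> M" for x y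
  proof (rule ccontr)
    assume "x \<noteq> y"
    then obtain U where U: "openin X U" "x \<in> U" "y \<notin> U"
      using t1 xy unfolding t1_space_def M_def by meson
    then show False using base[OF U(1,2)] E xy unfolding M_def by auto
  qed
  have f_eq_0: "f x y = 0 \<longleftrightarrow> x = y" if "x \<in> M" "y \<in> M" for x y
    using that separated[of x y] refl[of x] unfolding f_zero_iff M_def by auto
  have f_sym: "f x y = f y x" for x y
  proof -
    have "E n x y \<longleftrightarrow> E n y x" for n using sym[of n] by (intro iffI)
    then show ?thesis by (simp add: f_def)
  qed
  have weak: "f x w \<le> 2 * c" if xyzw: "x \<in> M" "y \<in> M" "z \<in> M" "w \<in> M"
    and c: "f x y \<le> c" "f y z \<le> c" "f z w \<le> c" for x y z w c
  proof (rule ccontr)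
    assume "\<not> f x w \<le> 2 * c"
    then have less: "2 * c < f x w" by simp
    then have "\<not> (\<forall>n. E n x w)" using f_zero_iff c(1) nonneg[of x y] by force
    then obtain k where k: "f x w = (1 / 2) ^ k" "f x w \<noteq> 0" by (auto simp: f_def split: if_splits)
    with less have "c < (1 / 2) ^ Suc k" by simp
    with c have "E (Suc k) x y" "E (Suc k) y z" "E (Suc k) z w"
      by (simp_all only: f_less_iff[OF xyzw(1,2), symmetric] f_less_iff[OF xyzw(2,3), symmetric]
          f_less_iff[OF xyzw(3,4), symmetric] le_less_trans)
    then have "E k x w" by (rule triple)
    then show False using f_less_iff[of x w k] xyzw k by simp
  qed
  have "\<exists>d. Metric_space M d \<and> (\<forall>x\<in>M. \<forall>y\<in>M. d x y \<le> f x y \<and> f x y \<le> 2 * d x y)"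
    by (rule metric_from_gauge) (fact nonneg f_eq_0 f_sym weak)+
  then obtain d where d: "Metric_space M d"
    and bounds: "\<forall>x\<in>M. \<forall>y\<in>M. d x y \<le> f x y \<and> f x y \<le> 2 * d x y"
    by (elim exE conjE)
  have upper: "d x y \<le> f x y" and lower: "f x y \<le> 2 * d x y" if "x \<in> M" "y \<in> M" for x y
    using bounds that by simp_all
  interpret Metric_space M d by (rule d)
  have "openin X U \<longleftrightarrow> openin mtopology U" for U
  proof
    assume U: "openin X U"
    show "openin mtopology U"
      unfolding openin_mtopology
    proof (intro conjI allI impI)
      show "U \<subseteq> M" using U openin_subset unfolding M_def by blast
      fix x assume x: "x \<in> U"
      obtain n where n: "\<forall>y\<in>M. E n x y \<longrightarrow> y \<in> U" using base[OF U x] unfolding M_def by blast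
      have "y \<in> U" if "x \<in> M" "y \<in> M" "d x y < (1 / 2) ^ n / 2" for y
      proof -
        have "f x y < (1 / 2) ^ n" using lower[of x y] that by simp
        then have "E n x y" using f_less_iff[OF that(1,2)] by simp
        then show ?thesis using n that(2) by simp
      qed
      then have "mball x ((1 / 2) ^ n / 2) \<subseteq> U" by auto
      then show "\<exists>r>0. mball x r \<subseteq> U" by (intro exI[of _ "(1 / 2) ^ n / 2"]) simp
    qed
  next
    assume U: "openin mtopology U"
    then have "U \<subseteq> M" by (simp add: openin_mtopology)
    show "openin X U"
    proof (subst openin_subopen, intro ballI)
      fix x assume x: "x \<in> U"
      then obtain r where r: "r > 0" "mball x r \<subseteq> U" using U by (meson openin_mtopology)
      obtain n where n: "(1 / 2) ^ n < r" using real_arch_pow_inv[OF r(1), of "1 / 2"] by auto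
      obtain V where V: "openin X V" "x \<in> V" "\<forall>y\<in>V. E n x y"
        using nhd[of x n] x \<open>U \<subseteq> M\<close> unfolding M_def by (meson subsetD)
      have "V \<subseteq> U"
      proof
        fix y assume y: "y \<in> V"
        then have "y \<in> M" using V(1) openin_subset unfolding M_def by blast
        have "x \<in> M" using x \<open>U \<subseteq> M\<close> by blast
        then have "d x y < r" using upper[OF \<open>x \<in> M\<close> \<open>y \<in> M\<close>] f_less_iff[OF \<open>x \<in> M\<close> \<open>y \<in> M\<close>, of n] V(3) y n
          by (meson le_less_trans less_trans)
        then show "y \<in> U" using r \<open>y \<in> M\<close> \<open>x \<in> M\<close> by auto
      qed
      with V show "\<exists>V. openin X V \<and> x \<in> V \<and> V \<subseteq> U" by blast
    qed
  qed
  then have "X = mtopology" by (simp add: topology_eq)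
  then show ?thesis using metrizable_space_mtopology by simp
qed

section \<open>Biradial spaces\<close>

lemma metrizable_imp_biradial_space:
  assumes "metrizable_space X"
  shows "biradial_space X"
  unfolding biradial_space_def
proof (intro allI impI, elim conjE)
  fix \<zeta> x assume \<zeta>: "prefilter_on X \<zeta>" and x: "x \<in> topspace X" and conv: "family_converges X \<zeta> x"
  obtain M d where d: "Metric_space M d" and X: "X = Metric_space.mtopology M d"
    using assms unfolding metrizable_space_def by blast
  interpret Metric_space M d by (rule d)
  have x: "x \<in> M" using x X by simp
  let ?\<eta> = "mball x ` {0<..}"
  have "chain\<^sub>\<subseteq> ?\<eta>"
    unfolding chain_subset_def
  proof (intro ballI)
    fix P Q assume "P \<in> ?\<eta>" "Q \<in> ?\<eta>"
    then obtain r s where "P = mball x r" "Q = mball x s" by blast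
    then show "P \<subseteq> Q \<or> Q \<subseteq> P" using mball_subset_concentric[of r s] mball_subset_concentric[of s r]
      by (cases "r \<le> s") auto
  qed
  moreover have "\<forall>Q\<in>?\<eta>. Q \<noteq> {} \<and> Q \<subseteq> topspace X" using x X by auto
  moreover have "family_converges X ?\<eta> x"
    unfolding family_converges_def X openin_mtopology by blast
  moreover have "synchronous \<zeta> ?\<eta>"
    unfolding synchronous_def
  proof (intro ballI)
    fix P Q assume P: "P \<in> \<zeta>" and "Q \<in> ?\<eta>"
    then have "openin X Q" "x \<in> Q" using x X by auto
    then obtain P' where "P' \<in> \<zeta>" "P' \<subseteq> Q" using conv unfolding family_converges_def by blast
    moreover obtain P'' where "P'' \<in> \<zeta>" "P'' \<subseteq> P \<inter> P'"
      using \<zeta> P \<open>P' \<in> \<zeta>\<close> unfolding prefilter_on_def by meson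
    moreover have "P'' \<noteq> {}" using \<zeta> \<open>P'' \<in> \<zeta>\<close> unfolding prefilter_on_def by blast
    ultimately show "P \<inter> Q \<noteq> {}" by blast
  qed
  ultimately show "\<exists>\<eta>. chain\<^sub>\<subseteq> \<eta> \<and> (\<forall>Q\<in>\<eta>. Q \<noteq> {} \<and> Q \<subseteq> topspace X) \<and>
      family_converges X \<eta> x \<and> synchronous \<zeta> \<eta>" by blast
qed

text \<open>
  The test prefilter consists of the traces of the dense open sets on the neighbourhoods of \<open>x\<close>: a
  set that meets all of them cannot be nowhere dense, because the complement of the closure of a
  nowhere dense set is open and dense.
\<close>

lemma biradial_somewhere_dense_chain:
  assumes X: "biradial_space X" and x: "x \<in> topspace X"
  shows "\<exists>\<eta>. chain\<^sub>\<subseteq> \<eta> \<and> family_converges X \<eta> x \<and>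
    (\<forall>Q\<in>\<eta>. Q \<subseteq> topspace X \<and> X interior_of (X closure_of Q) \<noteq> {})"
proof -
  define \<zeta> where "\<zeta> = {U \<inter> D | U D. openin X U \<and> x \<in> U \<and> openin X D \<and> X closure_of D = topspace X}"
  have "prefilter_on X \<zeta>"
    unfolding prefilter_on_def
  proof (intro conjI ballI)
    fix P assume "P \<in> \<zeta>"
    then obtain U D where P: "P = U \<inter> D" "openin X U" "x \<in> U" "X closure_of D = topspace X"
      unfolding \<zeta>_def by blast
    show "P \<noteq> {}" using P x in_closure_of[of x X D] by blast
    show "P \<subseteq> topspace X" using P openin_subset by blast
  next
    fix P1 P2 assume "P1 \<in> \<zeta>" "P2 \<in> \<zeta>"
    then obtain U1 D1 U2 D2 where
      1: "P1 = U1 \<inter> D1" "openin X U1" "x \<in> U1" "openin X D1" "X closure_of D1 = topspace X" and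
      2: "P2 = U2 \<inter> D2" "openin X U2" "x \<in> U2" "openin X D2" "X closure_of D2 = topspace X"
      unfolding \<zeta>_def by blast
    have "X closure_of (D1 \<inter> D2) = topspace X"
    proof
      show "X closure_of (D1 \<inter> D2) \<subseteq> topspace X" by (rule closure_of_subset_topspace)
      show "topspace X \<subseteq> X closure_of (D1 \<inter> D2)"
      proof (intro subsetI, unfold in_closure_of, intro conjI allI impI)
        fix y O' assume y: "y \<in> topspace X" and O': "y \<in> O' \<and> openin X O'"
        then obtain z where "z \<in> D1" "z \<in> O'" using 1 in_closure_of[of y X D1] by blast
        moreover have "openin X (O' \<inter> D1)" "z \<in> topspace X"
          using O' 1 \<open>z \<in> D1\<close> openin_subset by blast+
        ultimately show "\<exists>z. z \<in> D1 \<inter> D2 \<and> z \<in> O'"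
          using 2 in_closure_of[of z X D2] by blast
      qed
    qed
    then have "(U1 \<inter> U2) \<inter> (D1 \<inter> D2) \<in> \<zeta>" using 1 2 unfolding \<zeta>_def by blast
    then show "\<exists>P\<in>\<zeta>. P \<subseteq> P1 \<inter> P2" using 1 2 by (intro bexI) auto
  qed
  moreover have "family_converges X \<zeta> x"
    unfolding family_converges_def
  proof (intro allI impI)
    fix U assume U: "openin X U \<and> x \<in> U"
    then have "U \<inter> topspace X \<in> \<zeta>"
      unfolding \<zeta>_def using closure_of_topspace[of X] openin_topspace[of X] by blast
    then show "\<exists>P\<in>\<zeta>. P \<subseteq> U" by blast
  qed
  ultimately obtain \<eta> where \<eta>: "chain\<^sub>\<subseteq> \<eta>" "\<forall>Q\<in>\<eta>. Q \<noteq> {} \<and> Q \<subseteq> topspace X"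
    "family_converges X \<eta> x" "synchronous \<zeta> \<eta>"
    using X x unfolding biradial_space_def by blast
  have "X interior_of (X closure_of Q) \<noteq> {}" if Q: "Q \<in> \<eta>" for Q
  proof
    assume nowhere: "X interior_of (X closure_of Q) = {}"
    let ?D = "topspace X - X closure_of Q"
    have "X closure_of ?D = topspace X" using nowhere by (simp add: closure_of_complement)
    moreover have "openin X ?D" by (intro openin_diff) auto
    ultimately have "topspace X \<inter> ?D \<in> \<zeta>"
      unfolding \<zeta>_def using x openin_topspace[of X] by blast
    then have "topspace X \<inter> ?D \<inter> Q \<noteq> {}" using \<eta>(4) Q unfolding synchronous_def by blast
    moreover have "Q \<subseteq> X closure_of Q" using \<eta>(2) Q by (intro closure_of_subset) blast
    ultimately show False by blast
  qed
  then show ?thesis using \<eta> by (intro exI[of _ \<eta>]) simp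
qed

lemma gdelta_in_singletonD:
  fixes X :: "'b topology"
  assumes "gdelta_in X {x}"
  shows "\<exists>C::nat \<Rightarrow> 'b set. (\<forall>n. openin X (C n) \<and> x \<in> C n) \<and> (\<forall>y. (\<forall>n. y \<in> C n) \<longrightarrow> y = x)"
proof -
  have "\<exists>C::nat \<Rightarrow> 'b set. (\<forall>n. openin X (C n)) \<and> (\<forall>n. C (Suc n) \<subseteq> C n) \<and> \<Inter>(range C) = {x}"
    using assms by (simp only: gdelta_in_descending)
  then obtain C :: "nat \<Rightarrow> 'b set" where C: "\<forall>n. openin X (C n)" "\<Inter>(range C) = {x}"
    by (elim exE conjE)
  have "y \<in> \<Inter>(range C) \<longleftrightarrow> y = x" for y using C(2) by simp
  then have "(\<forall>n. y \<in> C n) \<longleftrightarrow> y = x" for y by simp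
  with C(1) show ?thesis by (intro exI[of _ C]) simp
qed

text \<open>
  Choose members of the chain below the open sets whose intersection is \<open>{x}\<close>. A member of the chain
  that contains none of the chosen ones lies below all of them, hence is \<open>{x}\<close>; in that case the
  constant sequence \<open>{x}\<close> converges.
\<close>

lemma biradial_gdelta_somewhere_dense_sequence:
  fixes X :: "'b topology"
  assumes X: "biradial_space X" and x: "x \<in> topspace X" and gdelta: "gdelta_in X {x}"
  shows "\<exists>Q :: nat \<Rightarrow> 'b set.
    (\<forall>n. Q n \<subseteq> topspace X \<and> X interior_of (X closure_of Q n) \<noteq> {}) \<and>
    (\<forall>U. openin X U \<and> x \<in> U \<longrightarrow> (\<exists>n. Q n \<subseteq> U))"
proof -
  obtain \<eta> where chain: "chain\<^sub>\<subseteq> \<eta>" and conv: "family_converges X \<eta> x"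
    and dense: "\<forall>Q\<in>\<eta>. Q \<subseteq> topspace X \<and> X interior_of (X closure_of Q) \<noteq> {}"
    using biradial_somewhere_dense_chain[OF X x] by (elim exE conjE)
  obtain C :: "nat \<Rightarrow> 'b set" where C: "\<forall>n. openin X (C n) \<and> x \<in> C n"
    "\<forall>y. (\<forall>n. y \<in> C n) \<longrightarrow> y = x"
    using gdelta_in_singletonD[OF gdelta] by (elim exE conjE)
  have "\<forall>n. \<exists>P. P \<in> \<eta> \<and> P \<subseteq> C n"
    using conv C(1) unfolding family_converges_def by blast
  then obtain P where P: "\<forall>n. P n \<in> \<eta> \<and> P n \<subseteq> C n" using choice by meson
  show ?thesis
  proof (cases "{x} \<in> \<eta>")
    case True
    have "{x} \<subseteq> topspace X \<and> X interior_of (X closure_of {x}) \<noteq> {}"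
      using dense True by (rule bspec)
    then show ?thesis by (intro exI[of _ "\<lambda>_. {x}"]) simp
  next
    case False
    have "\<exists>n. P n \<subseteq> U" if U: "openin X U" "x \<in> U" for U
    proof -
      have "\<exists>Q\<in>\<eta>. Q \<subseteq> U" using conv U by (simp add: family_converges_def)
      then obtain Q where Q: "Q \<in> \<eta>" "Q \<subseteq> U" by (elim bexE)
      have "\<exists>n. P n \<subseteq> Q"
      proof (rule ccontr)
        assume none: "\<nexists>n. P n \<subseteq> Q"
        have below: "Q \<subseteq> P n" for n
          using chain P Q(1) none unfolding chain_subset_def by metis
        have "y = x" if "y \<in> Q" for y
        proof -
          have "y \<in> C n" for n using that below[of n] P by auto
          then show ?thesis using C(2) by simp
        qed
        moreover have "Q \<noteq> {}" using dense Q(1) by auto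
        ultimately have "Q = {x}" by blast
        with False Q(1) show False by simp
      qed
      then show ?thesis using Q(2) by (meson subset_trans)
    qed
    moreover have "P n \<subseteq> topspace X \<and> X interior_of (X closure_of P n) \<noteq> {}" for n
      using P dense by simp
    ultimately show ?thesis by (intro exI[of _ P]) simp
  qed
qed

lemma countable_pseudocharacter_imp_t1_space:
  assumes "countable_pseudocharacter X"
  shows "t1_space X"
  unfolding t1_space_def
proof (intro ballI impI)
  fix x y assume x: "x \<in> topspace X" and "x \<noteq> y"
  have "gdelta_in X {x}" using assms x by (simp add: countable_pseudocharacter_def)
  then show "\<exists>U. openin X U \<and> x \<in> U \<and> y \<notin> U"
    using gdelta_in_singletonD \<open>x \<noteq> y\<close> by metis
qed

section \<open>Algebra of gyrogroups\<close>

context gyrogroup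
begin

abbreviation gplus (infixl "\<oplus>" 65) where "x \<oplus> y \<equiv> gadd G x y"
abbreviation gminus ("\<ominus> _" [81] 80) where "\<ominus> x \<equiv> gneg G x"
abbreviation zero_element ("\<zero>") where "\<zero> \<equiv> gzero G"
abbreviation carrier_set ("C") where "C \<equiv> gcarrier G"

lemma gyr_closed: "\<lbrakk>x \<in> C; y \<in> C; z \<in> C\<rbrakk> \<Longrightarrow> gyr G x y z \<in> C"
  using gyr_automorphism[of x y] unfolding gyro_automorphism_def bij_betw_def by blast

lemma gyr_inject: "\<lbrakk>x \<in> C; y \<in> C; u \<in> C; v \<in> C; gyr G x y u = gyr G x y v\<rbrakk> \<Longrightarrow> u = v"
  using gyr_automorphism[of x y] unfolding gyro_automorphism_def bij_betw_def inj_on_def by blast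

lemma gyr_add: "\<lbrakk>x \<in> C; y \<in> C; u \<in> C; v \<in> C\<rbrakk> \<Longrightarrow> gyr G x y (u \<oplus> v) = gyr G x y u \<oplus> gyr G x y v"
  using gyr_automorphism[of x y] unfolding gyro_automorphism_def by blast

lemma neg_add_eq_gyr:
  assumes "x \<in> C" "y \<in> C"
  shows "\<ominus> x \<oplus> (x \<oplus> y) = gyr G (\<ominus> x) x y"
  using assms by (simp add: left_gyroassociative neg_closed neg_left zero_left gyr_closed)

lemma add_left_imp_eq:
  assumes "x \<in> C" "y \<in> C" "z \<in> C" "x \<oplus> y = x \<oplus> z"
  shows "y = z"
  using neg_add_eq_gyr[of x y] neg_add_eq_gyr[of x z] assms gyr_inject[of "\<ominus> x" x y z] neg_closed
  by simp

lemma gyr_zero_left: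
  assumes "x \<in> C" "z \<in> C"
  shows "gyr G \<zero> x z = z"
proof -
  have "x \<oplus> z = x \<oplus> gyr G \<zero> x z"
    using left_gyroassociative[of \<zero> x z] assms by (simp add: zero_closed add_closed zero_left)
  then show ?thesis using add_left_imp_eq[of x z "gyr G \<zero> x z"] assms
    by (simp add: gyr_closed zero_closed)
qed

text \<open>The left loop property at \<open>\<ominus> x\<close> and \<open>x\<close> makes the gyration that obstructs cancellation trivial.\<close>

lemma neg_add_cancel_left:
  assumes "x \<in> C" "y \<in> C"
  shows "\<ominus> x \<oplus> (x \<oplus> y) = y"
  using left_loop[of "\<ominus> x" x y] assms
  by (simp add: neg_add_eq_gyr neg_closed neg_left gyr_zero_left)

lemma neg_neg: "x \<in> C \<Longrightarrow> \<ominus> (\<ominus> x) = x"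
  using neg_add_cancel_left[of "\<ominus> x" x] by (simp add: neg_closed neg_left zero_right)

lemma add_neg_cancel_left:
  assumes "x \<in> C" "y \<in> C"
  shows "x \<oplus> (\<ominus> x \<oplus> y) = y"
  using neg_add_cancel_left[of "\<ominus> x" y] assms by (simp add: neg_closed neg_neg)

lemma gyr_zero: "\<lbrakk>x \<in> C; y \<in> C\<rbrakk> \<Longrightarrow> gyr G x y \<zero> = \<zero>"
  using gyr_add[of x y \<zero> \<zero>] add_left_imp_eq[of "gyr G x y \<zero>" "gyr G x y \<zero>" \<zero>]
  by (simp add: zero_closed zero_right gyr_closed)

lemma gyr_neg: "\<lbrakk>x \<in> C; y \<in> C; z \<in> C\<rbrakk> \<Longrightarrow> gyr G x y (\<ominus> z) = \<ominus> (gyr G x y z)"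
  using gyr_add[of x y z "\<ominus> z"] add_left_imp_eq[of "gyr G x y z" "gyr G x y (\<ominus> z)" "\<ominus> (gyr G x y z)"]
  by (simp add: neg_closed neg_right gyr_closed gyr_zero)

lemma gyr_invariant_subset: "gyr_invariant G A \<Longrightarrow> A \<subseteq> C"
  by (simp add: gyr_invariant_def)

lemma gyr_invariant_gyr: "\<lbrakk>gyr_invariant G A; x \<in> C; y \<in> C; a \<in> A\<rbrakk> \<Longrightarrow> gyr G x y a \<in> A"
  unfolding gyr_invariant_def by blast

lemma gyr_invariant_preimage:
  assumes "gyr_invariant G A" "x \<in> C" "y \<in> C" "a \<in> A"
  shows "\<exists>a'\<in>A. gyr G x y a' = a"
  using assms unfolding gyr_invariant_def by (metis imageE)

lemma gyr_invariantI:
  assumes "A \<subseteq> C"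
    and "\<And>x y a. \<lbrakk>x \<in> C; y \<in> C; a \<in> A\<rbrakk> \<Longrightarrow> gyr G x y a \<in> A"
    and "\<And>x y a. \<lbrakk>x \<in> C; y \<in> C; a \<in> A\<rbrakk> \<Longrightarrow> \<exists>a'\<in>A. gyr G x y a' = a"
  shows "gyr_invariant G A"
  unfolding gyr_invariant_def
proof (intro conjI ballI subset_antisym subsetI)
  fix x y a assume "x \<in> C" "y \<in> C" "a \<in> A"
  then show "a \<in> gyr G x y ` A" using assms(3) by blast
qed (use assms in auto)

lemma gyr_invariant_Int:
  assumes A: "gyr_invariant G A" and B: "gyr_invariant G B"
  shows "gyr_invariant G (A \<inter> B)"
proof (rule gyr_invariantI)
  fix x y c assume xy: "x \<in> C" "y \<in> C" and c: "c \<in> A \<inter> B"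
  obtain a where a: "a \<in> A" "gyr G x y a = c" using gyr_invariant_preimage[OF A xy] c by blast
  obtain b where b: "b \<in> B" "gyr G x y b = c" using gyr_invariant_preimage[OF B xy] c by blast
  have "a = b" using gyr_inject[OF xy] a b gyr_invariant_subset[OF A] gyr_invariant_subset[OF B] by blast
  then show "\<exists>a'\<in>A \<inter> B. gyr G x y a' = c" using a b by blast
qed (use gyr_invariant_subset[OF A] gyr_invariant_gyr[OF A] gyr_invariant_gyr[OF B] in auto)

lemma gyr_invariant_neg:
  assumes A: "gyr_invariant G A"
  shows "gyr_invariant G (gneg G ` A)"
proof (rule gyr_invariantI)
  fix x y c assume xy: "x \<in> C" "y \<in> C" and "c \<in> gneg G ` A"
  then obtain a where a: "a \<in> A" "c = \<ominus> a" by blast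
  then have "gyr G x y c = \<ominus> (gyr G x y a)"
    using xy gyr_invariant_subset[OF A] gyr_neg by blast
  then show "gyr G x y c \<in> gneg G ` A" using gyr_invariant_gyr[OF A xy] a by blast
  obtain b where b: "b \<in> A" "gyr G x y b = a" using gyr_invariant_preimage[OF A xy] a by blast
  then have "gyr G x y (\<ominus> b) = c"
    using xy gyr_invariant_subset[OF A] gyr_neg a by blast
  then show "\<exists>a'\<in>gneg G ` A. gyr G x y a' = c" using b by blast
qed (use gyr_invariant_subset[OF A] neg_closed in auto)

subsection \<open>The relation of differing by an element of a set\<close>

text \<open>
  For gyr-invariant sets, sums of sets become compositions of these relations, because the
  gyrations that appear when brackets are moved do not change the set. The calculus
  of sets in a group, with its associative sum, is thus replaced by the calculus of relations.
\<close>

definition near :: "'a set \<Rightarrow> 'a \<Rightarrow> 'a \<Rightarrow> bool" where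
  "near A x y \<longleftrightarrow> x \<in> C \<and> y \<in> C \<and> \<ominus> x \<oplus> y \<in> A"

lemma nearD: "near A x y \<Longrightarrow> x \<in> C \<and> y \<in> C"
  by (simp add: near_def)

lemma near_mono: "\<lbrakk>near A x y; A \<subseteq> B\<rbrakk> \<Longrightarrow> near B x y"
  by (auto simp: near_def)

lemma near_refl: "\<lbrakk>\<zero> \<in> A; x \<in> C\<rbrakk> \<Longrightarrow> near A x x"
  by (simp add: near_def neg_left)

lemma near_add: "\<lbrakk>x \<in> C; a \<in> A; A \<subseteq> C\<rbrakk> \<Longrightarrow> near A x (x \<oplus> a)"
  by (auto simp: near_def add_closed neg_add_cancel_left)

lemma nearE:
  assumes "near A x y"
  obtains a where "a \<in> A" "y = x \<oplus> a"
  using assms add_neg_cancel_left[of x y] unfolding near_def by metis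

lemma near_neg:
  assumes A: "gyr_invariant G A" and "near A x y"
  shows "near (gneg G ` A) y x"
proof -
  obtain a where a: "a \<in> A" "y = x \<oplus> a" using assms(2) by (rule nearE)
  have C: "x \<in> C" "a \<in> C" using assms a gyr_invariant_subset by (auto dest: nearD)
  have "x = y \<oplus> gyr G x a (\<ominus> a)"
    using left_gyroassociative[of x a "\<ominus> a"] C a by (simp add: neg_closed neg_right zero_right)
  also have "gyr G x a (\<ominus> a) = \<ominus> (gyr G x a a)" using C by (simp add: gyr_neg)
  finally have "x = y \<oplus> \<ominus> (gyr G x a a)" .
  moreover have "gyr G x a a \<in> A" using gyr_invariant_gyr[OF A] C a by blast
  moreover have "gneg G ` A \<subseteq> C" using gyr_invariant_subset[OF A] neg_closed by blast
  moreover have "y \<in> C" using assms by (auto dest: nearD)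
  ultimately show ?thesis using near_add[of y "\<ominus> (gyr G x a a)" "gneg G ` A"] by auto
qed

lemma near_trans:
  assumes B: "gyr_invariant G B" and A: "A \<subseteq> C" and xy: "near A x y" and yz: "near B y z"
  shows "near (gset_add G A B) x z"
proof -
  obtain a where a: "a \<in> A" "y = x \<oplus> a" using xy by (rule nearE)
  obtain b where b: "b \<in> B" "z = y \<oplus> b" using yz by (rule nearE)
  have C: "x \<in> C" "a \<in> C" using xy a A by (auto dest: nearD)
  obtain b' where b': "b' \<in> B" "gyr G x a b' = b"
    using gyr_invariant_preimage[OF B C b(1)] by blast
  have "b' \<in> C" using b' gyr_invariant_subset[OF B] by blast
  then have "z = x \<oplus> (a \<oplus> b')" using left_gyroassociative[of x a b'] a b b' C by simp
  moreover have "a \<oplus> b' \<in> gset_add G A B" using a b' unfolding gset_add_def by blast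
  moreover have "gset_add G A B \<subseteq> C"
    using A gyr_invariant_subset[OF B] add_closed unfolding gset_add_def by blast
  ultimately show ?thesis using near_add C by simp
qed

lemma near_split:
  assumes A: "A \<subseteq> C" and B: "gyr_invariant G B" and xz: "near (gset_add G A B) x z"
  obtains y where "near A x y" "near B y z"
proof -
  obtain c where c: "c \<in> gset_add G A B" "z = x \<oplus> c" using xz by (rule nearE)
  then obtain a b where ab: "a \<in> A" "b \<in> B" "c = a \<oplus> b" unfolding gset_add_def by blast
  have C: "x \<in> C" "a \<in> C" "b \<in> C" using xz ab A gyr_invariant_subset[OF B] by (auto dest: nearD)
  have z: "z = (x \<oplus> a) \<oplus> gyr G x a b" using left_gyroassociative[of x a b] c ab C by simp
  have "near A x (x \<oplus> a)" using near_add A C ab by simp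
  moreover have "near B (x \<oplus> a) z"
    unfolding z using near_add[of "x \<oplus> a" "gyr G x a b" B] gyr_invariant_gyr[OF B] gyr_invariant_subset[OF B] C ab
    by (simp add: add_closed)
  ultimately show thesis by (rule that)
qed

lemma near_translate:
  assumes A: "gyr_invariant G A" and xy: "near A x y" and c: "c \<in> C"
  shows "near A (c \<oplus> x) (c \<oplus> y)"
proof -
  obtain a where a: "a \<in> A" "y = x \<oplus> a" using xy by (rule nearE)
  have C: "x \<in> C" "a \<in> C" using xy a gyr_invariant_subset[OF A] by (auto dest: nearD)
  have "c \<oplus> y = (c \<oplus> x) \<oplus> gyr G c x a" using left_gyroassociative[of c x a] a C c by simp
  then show ?thesis
    using near_add[of "c \<oplus> x" "gyr G c x a" A] gyr_invariant_gyr[OF A] gyr_invariant_subset[OF A] C c a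
    by (simp add: add_closed)
qed

end

section \<open>Gyr-invariant neighbourhoods of the identity\<close>

context topological_gyrogroup
begin

definition gyr_nbhd :: "'a set \<Rightarrow> bool" where
  "gyr_nbhd V \<longleftrightarrow> neighbourhood_in T \<zero> V \<and> gyr_invariant G V"

lemma gyr_nbhd_subset: "gyr_nbhd V \<Longrightarrow> V \<subseteq> C"
  by (simp add: gyr_nbhd_def gyr_invariant_def)

lemma gyr_nbhd_invariant: "gyr_nbhd V \<Longrightarrow> gyr_invariant G V"
  by (simp add: gyr_nbhd_def)

lemma gyr_nbhd_zero: "gyr_nbhd V \<Longrightarrow> \<zero> \<in> V"
  by (auto simp: gyr_nbhd_def neighbourhood_in_def)

lemma gyr_nbhd_open: "gyr_nbhd V \<Longrightarrow> \<exists>U. openin T U \<and> \<zero> \<in> U \<and> U \<subseteq> V"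
  by (simp add: gyr_nbhd_def neighbourhood_in_def)

lemma gyr_nbhdI: "\<lbrakk>openin T U; \<zero> \<in> U; U \<subseteq> V; gyr_invariant G V\<rbrakk> \<Longrightarrow> gyr_nbhd V"
  using topspace_eq by (auto simp: gyr_nbhd_def neighbourhood_in_def gyr_invariant_def)

lemma openin_left_translate:
  assumes "openin T U" "a \<in> C"
  shows "openin T {x \<in> C. a \<oplus> x \<in> U}"
proof -
  have "continuous_map T (prod_topology T T) (\<lambda>x. (a, x))"
    using assms(2) by (simp add: continuous_map_pairwise o_def topspace_eq)
  from continuous_map_compose[OF this continuous_add]
  have "continuous_map T T (\<lambda>x. a \<oplus> x)" by (simp add: o_def)
  then show ?thesis
    using openin_continuous_map_preimage[of T T "\<lambda>x. a \<oplus> x" U] assms(1) by (simp add: topspace_eq)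
qed

lemma openin_right_translate:
  assumes "openin T U" "a \<in> C"
  shows "openin T {x \<in> C. x \<oplus> a \<in> U}"
proof -
  have "continuous_map T (prod_topology T T) (\<lambda>x. (x, a))"
    using assms(2) by (simp add: continuous_map_pairwise o_def topspace_eq)
  from continuous_map_compose[OF this continuous_add]
  have "continuous_map T T (\<lambda>x. x \<oplus> a)" by (simp add: o_def)
  then show ?thesis
    using openin_continuous_map_preimage[of T T "\<lambda>x. x \<oplus> a" U] assms(1) by (simp add: topspace_eq)
qed

lemma gyr_nbhd_Int:
  assumes "gyr_nbhd V" "gyr_nbhd W"
  shows "gyr_nbhd (V \<inter> W)"
proof -
  obtain O1 where "openin T O1" "\<zero> \<in> O1" "O1 \<subseteq> V" using gyr_nbhd_open[OF assms(1)] by blast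
  moreover obtain O2 where "openin T O2" "\<zero> \<in> O2" "O2 \<subseteq> W" using gyr_nbhd_open[OF assms(2)] by blast
  ultimately show ?thesis
    using assms gyr_nbhd_invariant gyr_invariant_Int by (intro gyr_nbhdI[of "O1 \<inter> O2"]) auto
qed

lemma gyr_nbhd_neg:
  assumes "gyr_nbhd V"
  shows "gyr_nbhd (gneg G ` V)"
proof -
  obtain U where U: "openin T U" "\<zero> \<in> U" "U \<subseteq> V" using gyr_nbhd_open[OF assms] by blast
  have "openin T {x \<in> C. \<ominus> x \<in> U}"
    using openin_continuous_map_preimage[OF continuous_neg U(1)] by (simp add: topspace_eq)
  moreover have "\<ominus> \<zero> = \<zero>"
    using neg_left[of \<zero>] zero_right[of "\<ominus> \<zero>"] by (simp add: zero_closed neg_closed)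
  then have "\<zero> \<in> {x \<in> C. \<ominus> x \<in> U}" using U zero_closed by simp
  moreover have "{x \<in> C. \<ominus> x \<in> U} \<subseteq> gneg G ` V"
  proof
    fix x assume "x \<in> {x \<in> C. \<ominus> x \<in> U}"
    then have "\<ominus> x \<in> V" "x = \<ominus> (\<ominus> x)" using U neg_neg by auto
    then show "x \<in> gneg G ` V" by blast
  qed
  ultimately show ?thesis
    using gyr_invariant_neg gyr_nbhd_invariant[OF assms] by (intro gyr_nbhdI)
qed

end

context strongly_topological_gyrogroup
begin

lemma gyr_nbhd_in_open:
  assumes "openin T U" "\<zero> \<in> U"
  shows "\<exists>V. gyr_nbhd V \<and> V \<subseteq> U"
proof -
  have "neighbourhood_in T \<zero> U"
    using assms openin_subset unfolding neighbourhood_in_def by blast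
  then show ?thesis using gyr_invariant_neighbourhoods unfolding gyr_nbhd_def by blast
qed

lemma gyr_nbhd_exists: "\<exists>V. gyr_nbhd V"
  using gyr_nbhd_in_open[of C] openin_topspace[of T] zero_closed topspace_eq by auto

lemma gyr_nbhd_half:
  assumes "gyr_nbhd W"
  shows "\<exists>V. gyr_nbhd V \<and> gset_add G V V \<subseteq> W"
proof -
  obtain U where U: "openin T U" "\<zero> \<in> U" "U \<subseteq> W" using gyr_nbhd_open[OF assms] by blast
  let ?S = "{p \<in> topspace (prod_topology T T). (case p of (x, y) \<Rightarrow> x \<oplus> y) \<in> U}"
  have "openin (prod_topology T T) ?S"
    by (rule openin_continuous_map_preimage[OF continuous_add U(1)])
  moreover have "(\<zero>, \<zero>) \<in> ?S" using U by (simp add: topspace_eq zero_closed zero_left)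
  ultimately have "\<exists>V1 V2. openin T V1 \<and> openin T V2 \<and> \<zero> \<in> V1 \<and> \<zero> \<in> V2 \<and> V1 \<times> V2 \<subseteq> ?S"
    unfolding openin_prod_topology_alt by blast
  then obtain V1 V2 where V: "openin T V1" "openin T V2" "\<zero> \<in> V1" "\<zero> \<in> V2" "V1 \<times> V2 \<subseteq> ?S"
    by blast
  obtain V where "gyr_nbhd V" "V \<subseteq> V1 \<inter> V2"
    using gyr_nbhd_in_open[of "V1 \<inter> V2"] V by blast
  moreover have "gset_add G V V \<subseteq> W"
    using \<open>V \<subseteq> V1 \<inter> V2\<close> V(5) U(3) unfolding gset_add_def by fastforce
  ultimately show ?thesis by blast
qed

end

section \<open>The coset space of a neutral strong subgyrogroup\<close>

locale neutral_coset_space = strongly_topological_gyrogroup G T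
  for G :: "('a, 'm) gyrostructure_scheme" (structure) and T :: "'a topology" +
  fixes H :: "'a set"
  assumes strong: "strong_subgyrogroup G H"
    and neutral: "neutral_in G T H"
begin

abbreviation coset :: "'a \<Rightarrow> 'a set" ("\<pi>") where "\<pi> \<equiv> left_coset G H"

lemma H_invariant: "gyr_invariant G H"
  using strong by (simp add: strong_subgyrogroup_def)

lemma H_subset: "H \<subseteq> C"
  using H_invariant by (rule gyr_invariant_subset)

lemma H_zero: "\<zero> \<in> H"
proof -
  obtain h where h: "h \<in> H" using strong unfolding strong_subgyrogroup_def subgyrogroup_def by blast
  then have "\<ominus> h \<oplus> h \<in> H" using strong unfolding strong_subgyrogroup_def subgyrogroup_def by blast
  then show ?thesis using h H_subset neg_left by auto
qed

lemma near_H_sym: "near H x y \<Longrightarrow> near H y x"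
  using near_neg[OF H_invariant] near_mono[of "gneg G ` H" y x H] strong
  unfolding strong_subgyrogroup_def subgyrogroup_def by blast

lemma near_H_trans: "\<lbrakk>near H x y; near H y z\<rbrakk> \<Longrightarrow> near H x z"
  using near_trans[OF H_invariant H_subset, of x y z] near_mono[of "gset_add G H H" x z H] strong
  unfolding strong_subgyrogroup_def subgyrogroup_def gset_add_def by blast

lemma mem_coset_iff: "x \<in> C \<Longrightarrow> y \<in> \<pi> x \<longleftrightarrow> near H x y"
  using near_add[of x _ H] H_subset by (auto simp: left_coset_def gset_add_def elim: nearE)

lemma coset_eq_iff:
  assumes "x \<in> C" "y \<in> C"
  shows "\<pi> x = \<pi> y \<longleftrightarrow> near H x y"
proof
  assume "\<pi> x = \<pi> y"
  then show "near H x y"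
    using mem_coset_iff[of x y] mem_coset_iff[of y y] near_refl[OF H_zero] assms by simp
next
  assume "near H x y"
  then have "z \<in> \<pi> x \<longleftrightarrow> z \<in> \<pi> y" for z
    using mem_coset_iff assms near_H_sym near_H_trans by metis
  then show "\<pi> x = \<pi> y" by blast
qed

lemma topspace_coset_space: "topspace (coset_space G T H) = \<pi> ` C"
  by (simp add: coset_space_def topspace_quotient_topology topspace_eq)

lemma openin_coset_space:
  "openin (coset_space G T H) U \<longleftrightarrow> U \<subseteq> \<pi> ` C \<and> openin T {x \<in> C. \<pi> x \<in> U}"
  by (simp add: coset_space_def openin_quotient_topology topspace_eq)

text \<open>
  If \<open>x\<close> lies in the coset of some \<open>u \<in> U\<close>, then \<open>u = x \<oplus> h\<close> with \<open>h \<in> H\<close>, and the right translation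
  by this \<open>h\<close> pulls \<open>U\<close> back to a neighbourhood of \<open>x\<close> inside the saturation of \<open>U\<close>.
\<close>

lemma openin_coset_image:
  assumes U: "openin T U"
  shows "openin (coset_space G T H) (\<pi> ` U)"
  unfolding openin_coset_space
proof
  have "U \<subseteq> C" using openin_subset[OF U] topspace_eq by simp
  then show "\<pi> ` U \<subseteq> \<pi> ` C" by blast
  have "\<exists>V. openin T V \<and> x \<in> V \<and> V \<subseteq> {x \<in> C. \<pi> x \<in> \<pi> ` U}" if x: "x \<in> {x \<in> C. \<pi> x \<in> \<pi> ` U}" for x
  proof -
    obtain u where u: "u \<in> U" "\<pi> x = \<pi> u" using x by blast
    then have "near H x u" using coset_eq_iff x \<open>U \<subseteq> C\<close> by blast
    then obtain h where h: "h \<in> H" "u = x \<oplus> h" by (rule nearE)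
    have hC: "h \<in> C" using h H_subset by blast
    let ?V = "{y \<in> C. y \<oplus> h \<in> U}"
    have "y \<in> {x \<in> C. \<pi> x \<in> \<pi> ` U}" if "y \<in> ?V" for y
    proof -
      have "near H y (y \<oplus> h)" using near_add that h H_subset by simp
      then have "\<pi> y = \<pi> (y \<oplus> h)" using coset_eq_iff that hC add_closed by simp
      then show ?thesis using that by auto
    qed
    moreover have "openin T ?V" using openin_right_translate[OF U hC] .
    moreover have "x \<in> ?V" using x h u by simp
    ultimately show ?thesis by blast
  qed
  then show "openin T {x \<in> C. \<pi> x \<in> \<pi> ` U}" by (subst openin_subopen) blast
qed

text \<open>
  These relations play the role of the entourages. In a group, \<open>cnear V\<close> relates \<open>x H\<close> to the
  cosets contained in \<open>x H V H\<close>.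
\<close>

definition cnear :: "'a set \<Rightarrow> 'a set \<Rightarrow> 'a set \<Rightarrow> bool" where
  "cnear V P Q \<longleftrightarrow> (\<exists>x y. near V x y \<and> P = \<pi> x \<and> Q = \<pi> y)"

lemma cnear_mono: "\<lbrakk>cnear V P Q; V \<subseteq> W\<rbrakk> \<Longrightarrow> cnear W P Q"
  unfolding cnear_def using near_mono by blast

lemma cnear_topspace: "cnear V P Q \<Longrightarrow> P \<in> topspace (coset_space G T H) \<and> Q \<in> topspace (coset_space G T H)"
  unfolding cnear_def topspace_coset_space using nearD by blast

lemma cnear_refl: "\<lbrakk>gyr_nbhd V; P \<in> topspace (coset_space G T H)\<rbrakk> \<Longrightarrow> cnear V P P"
  unfolding cnear_def topspace_coset_space using near_refl gyr_nbhd_zero by blast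

lemma cnear_near: "near V x y \<Longrightarrow> cnear V (\<pi> x) (\<pi> y)"
  unfolding cnear_def by blast

lemma cnear_translate:
  assumes V: "gyr_nbhd V" and xy: "x \<in> C" "y \<in> C" "cnear V (\<pi> x) (\<pi> y)" and c: "c \<in> C"
  shows "cnear V (\<pi> (c \<oplus> x)) (\<pi> (c \<oplus> y))"
proof -
  obtain x' y' where xy': "near V x' y'" "\<pi> x = \<pi> x'" "\<pi> y = \<pi> y'"
    using xy(3) unfolding cnear_def by blast
  have C': "x' \<in> C" "y' \<in> C" using nearD[OF xy'(1)] by simp_all
  have "near H x x'" "near H y y'" using coset_eq_iff xy' xy C' by blast+
  then have "near H (c \<oplus> x) (c \<oplus> x')" "near H (c \<oplus> y) (c \<oplus> y')"
    using near_translate[OF H_invariant] c by blast+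
  then have "\<pi> (c \<oplus> x) = \<pi> (c \<oplus> x')" "\<pi> (c \<oplus> y) = \<pi> (c \<oplus> y')"
    using coset_eq_iff xy C' c add_closed by simp_all
  then show ?thesis
    using cnear_near near_translate[OF gyr_nbhd_invariant[OF V] xy'(1) c] by simp
qed

text \<open>
  Neutrality lets a step inside a coset be moved past a small step, which is what keeps a composite
  of two of the coset relations small.
\<close>

lemma neutral_swap:
  assumes "gyr_nbhd U"
  shows "\<exists>V. gyr_nbhd V \<and> V \<subseteq> U \<and>
    (\<forall>x y z. near H x y \<longrightarrow> near V y z \<longrightarrow> (\<exists>w. near U x w \<and> near H w z))"
proof -
  obtain V0 where V0: "openin T V0" "\<zero> \<in> V0" "gset_add G H V0 \<subseteq> gset_add G U H"
    using neutral assms unfolding neutral_in_def gyr_nbhd_def by meson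
  obtain V1 where V1: "gyr_nbhd V1" "V1 \<subseteq> V0" using gyr_nbhd_in_open[OF V0(1,2)] by blast
  let ?V = "V1 \<inter> U"
  have V: "gyr_nbhd ?V" using V1(1) assms by (rule gyr_nbhd_Int)
  have sub: "gset_add G H ?V \<subseteq> gset_add G U H"
    using V0(3) V1(2) unfolding gset_add_def by blast
  have "\<exists>w. near U x w \<and> near H w z" if "near H x y" "near ?V y z" for x y z
  proof -
    have "near (gset_add G U H) x z"
      using near_trans[OF gyr_nbhd_invariant[OF V] H_subset that] sub by (rule near_mono)
    then show ?thesis by (rule near_split[OF gyr_nbhd_subset[OF assms] H_invariant]) blast
  qed
  with V show ?thesis by blast
qed

lemma cnear_compose:
  assumes W: "gyr_nbhd W"
  shows "\<exists>V. gyr_nbhd V \<and> (\<forall>P Q R. cnear V P Q \<longrightarrow> cnear V Q R \<longrightarrow> cnear W P R)"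
proof -
  obtain U where U: "gyr_nbhd U" "gset_add G U U \<subseteq> W" using gyr_nbhd_half[OF W] by blast
  obtain V where V: "gyr_nbhd V" "V \<subseteq> U"
    and swap: "\<And>x y z. \<lbrakk>near H x y; near V y z\<rbrakk> \<Longrightarrow> \<exists>w. near U x w \<and> near H w z"
    using neutral_swap[OF U(1)] by metis
  have "cnear W P R" if PQ: "cnear V P Q" and QR: "cnear V Q R" for P Q R
  proof -
    obtain x y where xy: "near V x y" "P = \<pi> x" "Q = \<pi> y" using PQ unfolding cnear_def by blast
    obtain y' z where yz: "near V y' z" "Q = \<pi> y'" "R = \<pi> z" using QR unfolding cnear_def by blast
    have "near H y y'" using coset_eq_iff xy yz nearD by metis
    then obtain w where w: "near U y w" "near H w z" using swap yz(1) by blast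
    have "near (gset_add G U U) x w"
      using near_trans[OF gyr_nbhd_invariant[OF U(1)] gyr_nbhd_subset[OF U(1)]] near_mono[OF xy(1) V(2)] w(1)
      by blast
    then have "near W x w" using U(2) by (rule near_mono)
    moreover have "\<pi> w = \<pi> z" using coset_eq_iff w(2) nearD by metis
    ultimately show ?thesis using cnear_near xy yz by metis
  qed
  with V show ?thesis by blast
qed

text \<open>Shrinking to \<open>V \<inter> \<ominus> V\<close> makes the relation symmetric.\<close>

lemma cnear_compose_symmetric:
  assumes W: "gyr_nbhd W"
  shows "\<exists>V. gyr_nbhd V \<and> (\<forall>P Q. cnear V P Q \<longrightarrow> cnear V Q P) \<and>
    (\<forall>P Q R. cnear V P Q \<longrightarrow> cnear V Q R \<longrightarrow> cnear W P R)"
proof -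
  obtain U where U: "gyr_nbhd U" "\<forall>P Q R. cnear U P Q \<longrightarrow> cnear U Q R \<longrightarrow> cnear W P R"
    using cnear_compose[OF W] by blast
  let ?V = "U \<inter> gneg G ` U"
  have V: "gyr_nbhd ?V" by (rule gyr_nbhd_Int[OF U(1) gyr_nbhd_neg[OF U(1)]])
  have "gneg G ` ?V \<subseteq> ?V"
    using gyr_nbhd_subset[OF U(1)] neg_neg by auto
  then have "near ?V y x" if "near ?V x y" for x y
    using near_neg[OF gyr_nbhd_invariant[OF V] that] near_mono by blast
  then have "\<forall>P Q. cnear ?V P Q \<longrightarrow> cnear ?V Q P" unfolding cnear_def by blast
  moreover have "\<forall>P Q R. cnear ?V P Q \<longrightarrow> cnear ?V Q R \<longrightarrow> cnear W P R"
    using U(2) cnear_mono[of ?V _ _ U] by blast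
  ultimately show ?thesis using V by blast
qed

lemma cnear_nbhd:
  assumes V: "gyr_nbhd V" and P: "P \<in> topspace (coset_space G T H)"
  shows "\<exists>U. openin (coset_space G T H) U \<and> P \<in> U \<and> (\<forall>Q\<in>U. cnear V P Q)"
proof -
  obtain x where x: "x \<in> C" "P = \<pi> x" using P unfolding topspace_coset_space by blast
  obtain U where U: "openin T U" "\<zero> \<in> U" "U \<subseteq> V" using gyr_nbhd_open[OF V] by blast
  let ?N = "{y \<in> C. \<ominus> x \<oplus> y \<in> U}"
  have "openin T ?N" using openin_left_translate[OF U(1)] x neg_closed by blast
  moreover have "x \<in> ?N" using x U neg_left by simp
  moreover have "cnear V P (\<pi> y)" if "y \<in> ?N" for y
    using that x U(3) cnear_near[of V x y] by (auto simp: near_def)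
  ultimately show ?thesis
    using openin_coset_image x by (intro exI[of _ "\<pi> ` ?N"]) blast
qed

text \<open>
  The preimage of an open set of cosets absorbs steps in \<open>H\<close> on the right only, while the
  relation on cosets also allows one before the small step; neutrality moves that step to the right.
\<close>

lemma cnear_base:
  assumes O: "openin (coset_space G T H) O'" and P: "P \<in> O'"
  shows "\<exists>V. gyr_nbhd V \<and> (\<forall>Q. cnear V P Q \<longrightarrow> Q \<in> O')"
proof -
  have "O' \<subseteq> \<pi> ` C" and open_pre: "openin T {x \<in> C. \<pi> x \<in> O'}" using O openin_coset_space by auto
  then obtain x where x: "x \<in> C" "P = \<pi> x" using P by blast
  have "openin T {u \<in> C. x \<oplus> u \<in> {x \<in> C. \<pi> x \<in> O'}}" by (rule openin_left_translate[OF open_pre x(1)])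
  moreover have "\<zero> \<in> {u \<in> C. x \<oplus> u \<in> {x \<in> C. \<pi> x \<in> O'}}" using x P zero_closed zero_right by simp
  ultimately obtain U where U: "gyr_nbhd U" "U \<subseteq> {u \<in> C. x \<oplus> u \<in> {x \<in> C. \<pi> x \<in> O'}}"
    using gyr_nbhd_in_open by blast
  have U_in: "\<pi> y \<in> O'" if "near U x y" for y
    using nearE[OF that] U(2) by blast
  obtain V where V: "gyr_nbhd V"
    and swap: "\<And>x y z. \<lbrakk>near H x y; near V y z\<rbrakk> \<Longrightarrow> \<exists>w. near U x w \<and> near H w z"
    using neutral_swap[OF U(1)] by metis
  have "Q \<in> O'" if "cnear V P Q" for Q
  proof -
    obtain x' y where xy: "near V x' y" "P = \<pi> x'" "Q = \<pi> y" using \<open>cnear V P Q\<close> unfolding cnear_def by blast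
    have "near H x x'" using coset_eq_iff x xy nearD by metis
    then obtain w where w: "near U x w" "near H w y" using swap xy(1) by blast
    have "\<pi> w = \<pi> y" using coset_eq_iff w(2) nearD by metis
    then show ?thesis using U_in[OF w(1)] xy by simp
  qed
  with V show ?thesis by blast
qed

text \<open>
  A set \<open>Q n\<close> of the sequence that lies close to the base coset has its closure close to the base coset
  too, so some small neighbourhood \<open>U n\<close>, placed at an interior point of that closure,
  has diameter bounded by the given entourage. Left translations move this bound to every point,
  and \<open>U n\<close> depends on \<open>n\<close> only. This is where the sets of the sequence have to be somewhere dense.
\<close>

lemma cnear_countable_base:
  assumes biradial: "biradial_space (coset_space G T H)"
    and gdelta: "gdelta_in (coset_space G T H) {\<pi> \<zero>}"
  shows "\<exists>U :: nat \<Rightarrow> 'a set. (\<forall>n. gyr_nbhd (U n)) \<and>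
    (\<forall>W. gyr_nbhd W \<longrightarrow> (\<exists>n. \<forall>P R. cnear (U n) P R \<longrightarrow> cnear W P R))"
proof -
  let ?X = "coset_space G T H"
  have base_point: "\<pi> \<zero> \<in> topspace ?X" using zero_closed topspace_coset_space by simp
  obtain Q :: "nat \<Rightarrow> 'a set set"
    where Q: "\<forall>n. Q n \<subseteq> topspace ?X \<and> ?X interior_of (?X closure_of Q n) \<noteq> {}"
      and Q_conv: "\<forall>U. openin ?X U \<and> \<pi> \<zero> \<in> U \<longrightarrow> (\<exists>n. Q n \<subseteq> U)"
    using biradial_gdelta_somewhere_dense_sequence[OF biradial base_point gdelta] by (elim exE conjE)
  have "\<exists>a U. a \<in> C \<and> gyr_nbhd U \<and> (\<forall>R. cnear U (\<pi> a) R \<longrightarrow> R \<in> ?X closure_of Q n)" for n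
  proof -
    let ?I = "?X interior_of (?X closure_of Q n)"
    have I: "openin ?X ?I" "?I \<subseteq> ?X closure_of Q n" by (simp_all add: interior_of_subset)
    obtain P where P: "P \<in> ?I" using Q by blast
    then have "P \<in> topspace ?X" using I(1) openin_subset by blast
    then obtain a where a: "a \<in> C" "P = \<pi> a" unfolding topspace_coset_space by blast
    obtain U where "gyr_nbhd U" "\<forall>R. cnear U P R \<longrightarrow> R \<in> ?I" using cnear_base[OF I(1) P] by blast
    with a I(2) show ?thesis by blast
  qed
  then obtain a U where a: "\<forall>n. a n \<in> C" and U: "\<forall>n. gyr_nbhd (U n)"
    and aU: "\<forall>n R. cnear (U n) (\<pi> (a n)) R \<longrightarrow> R \<in> ?X closure_of Q n"
    by metis
  have "\<exists>n. \<forall>P R. cnear (U n) P R \<longrightarrow> cnear W P R" if W: "gyr_nbhd W" for W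
  proof -
    obtain V1 where V1: "gyr_nbhd V1" "\<forall>P R. cnear V1 P R \<longrightarrow> cnear V1 R P"
      "\<forall>P R S. cnear V1 P R \<longrightarrow> cnear V1 R S \<longrightarrow> cnear W P S"
      using cnear_compose_symmetric[OF W] by blast
    obtain V2 where V2: "gyr_nbhd V2" "\<forall>P R. cnear V2 P R \<longrightarrow> cnear V2 R P"
      "\<forall>P R S. cnear V2 P R \<longrightarrow> cnear V2 R S \<longrightarrow> cnear V1 P S"
      using cnear_compose_symmetric[OF V1(1)] by blast
    obtain N where N: "openin ?X N" "\<pi> \<zero> \<in> N" "\<forall>R\<in>N. cnear V2 (\<pi> \<zero>) R"
      using cnear_nbhd[OF V2(1) base_point] by blast
    then obtain n where n: "Q n \<subseteq> N" using Q_conv by blast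
    have closure_near: "cnear V1 (\<pi> \<zero>) R" if R: "R \<in> ?X closure_of Q n" for R
    proof -
      have "R \<in> topspace ?X" using R by (simp add: in_closure_of)
      then obtain N' where N': "openin ?X N'" "R \<in> N'" "\<forall>S\<in>N'. cnear V2 R S"
        using cnear_nbhd[OF V2(1)] by blast
      then obtain S where "S \<in> Q n" "S \<in> N'" using R unfolding in_closure_of by blast
      then have "cnear V2 (\<pi> \<zero>) S" "cnear V2 S R" using n N(3) N'(3) V2(2) by blast+
      then show ?thesis using V2(3) by blast
    qed
    have small: "cnear W (\<pi> (a n)) R" if "cnear (U n) (\<pi> (a n)) R" for R
    proof -
      have "cnear (U n) (\<pi> (a n)) (\<pi> (a n))"
        using cnear_refl a U topspace_coset_space by blast
      then have "cnear V1 (\<pi> (a n)) (\<pi> \<zero>)" using closure_near aU V1(2) by blast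
      moreover have "cnear V1 (\<pi> \<zero>) R" using closure_near aU that by blast
      ultimately show ?thesis using V1(3) by blast
    qed
    have "cnear W P R" if PR: "cnear (U n) P R" for P R
    proof -
      obtain x y where xy: "near (U n) x y" "P = \<pi> x" "R = \<pi> y" using PR unfolding cnear_def by blast
      obtain u where u: "u \<in> U n" "y = x \<oplus> u" using xy(1) by (rule nearE)
      have U_subset: "U n \<subseteq> C" using U gyr_nbhd_subset by blast
      have an: "a n \<in> C" and in_C: "x \<in> C" "u \<in> C"
        using a nearD[OF xy(1)] u U_subset by auto
      \<comment> \<open>Carry the step \<open>u\<close> to \<open>a n\<close>, where it is known to be small, and back.\<close>
      have "near (U n) (a n) (a n \<oplus> u)" using near_add an u(1) U_subset by blast
      then have "cnear W (\<pi> (a n)) (\<pi> (a n \<oplus> u))" using small cnear_near by blast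
      then have "cnear W (\<pi> (\<ominus> a n \<oplus> a n)) (\<pi> (\<ominus> a n \<oplus> (a n \<oplus> u)))"
        using cnear_translate[OF W] an in_C add_closed neg_closed by blast
      then have "cnear W (\<pi> \<zero>) (\<pi> u)" using an in_C by (simp add: neg_left neg_add_cancel_left)
      then have "cnear W (\<pi> (x \<oplus> \<zero>)) (\<pi> (x \<oplus> u))"
        using cnear_translate[OF W] in_C zero_closed by blast
      then show ?thesis using xy u in_C by (simp add: zero_right)
    qed
    then show ?thesis by blast
  qed
  with U show ?thesis by blast
qed

lemma metrizable_coset_space:
  assumes biradial: "biradial_space (coset_space G T H)"
    and pseudo: "countable_pseudocharacter (coset_space G T H)"
  shows "metrizable_space (coset_space G T H)"
proof -
  let ?X = "coset_space G T H"
  have "gdelta_in ?X {\<pi> \<zero>}"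
    using pseudo zero_closed topspace_coset_space unfolding countable_pseudocharacter_def by blast
  then obtain U :: "nat \<Rightarrow> 'a set" where U: "\<forall>n. gyr_nbhd (U n)"
    and U_base: "\<forall>W. gyr_nbhd W \<longrightarrow> (\<exists>n. \<forall>P R. cnear (U n) P R \<longrightarrow> cnear W P R)"
    using cnear_countable_base[OF biradial] by blast
  \<comment> \<open>Each entourage is chosen below \<open>U n\<close>, to remain a base, and with its triple composite inside the
    previous one, as the metrization criterion demands.\<close>
  define good where "good V \<longleftrightarrow> gyr_nbhd V \<and> (\<forall>P R. cnear V P R \<longrightarrow> cnear V R P)" for V
  define finer where "finer n V V' \<longleftrightarrow> (\<forall>P R. cnear V' P R \<longrightarrow> cnear (U n) P R) \<and>
    (\<forall>P R S Z. cnear V' P R \<longrightarrow> cnear V' R S \<longrightarrow> cnear V' S Z \<longrightarrow> cnear V P Z)" for n V V'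
  have good_ex: "\<exists>V. good V"
    using gyr_nbhd_exists cnear_compose_symmetric unfolding good_def by blast
  have finer_ex: "\<exists>V'. good V' \<and> finer n V V'" if V: "good V" for V n
  proof -
    have "gyr_nbhd (V \<inter> U n)" using V U gyr_nbhd_Int unfolding good_def by blast
    then obtain V1 where V1: "gyr_nbhd V1"
      "\<forall>P R S. cnear V1 P R \<longrightarrow> cnear V1 R S \<longrightarrow> cnear (V \<inter> U n) P S"
      using cnear_compose by blast
    obtain V2 where V2: "gyr_nbhd V2" "\<forall>P R. cnear V2 P R \<longrightarrow> cnear V2 R P"
      "\<forall>P R S. cnear V2 P R \<longrightarrow> cnear V2 R S \<longrightarrow> cnear V1 P S"
      using cnear_compose_symmetric[OF V1(1)] by blast
    have 21: "cnear V1 P R" if "cnear V2 P R" for P R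
      using that V2(1,3) cnear_refl cnear_topspace by blast
    have 1: "cnear (V \<inter> U n) P R" if "cnear V1 P R" for P R
      using that V1 cnear_refl cnear_topspace by blast
    have "cnear (U n) P R" if "cnear V2 P R" for P R
      using 1[OF 21[OF that]] by (rule cnear_mono) simp
    moreover have "cnear V P Z" if "cnear V2 P R" "cnear V2 R S" "cnear V2 S Z" for P R S Z
    proof -
      have "cnear V1 P S" "cnear V1 S Z" using that V2(3) 21 by blast+
      then have "cnear (V \<inter> U n) P Z" using V1(2) by blast
      then show ?thesis by (rule cnear_mono) simp
    qed
    ultimately have "finer n V V2" unfolding finer_def by blast
    with V2 show ?thesis unfolding good_def by blast
  qed
  have "\<exists>V. \<forall>n. good (V n) \<and> finer n (V n) (V (Suc n))"
    by (rule dependent_nat_choice) (rule good_ex, rule finer_ex)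
  then obtain V where V: "\<And>n. good (V n)" and V_finer: "\<And>n. finer n (V n) (V (Suc n))"
    by auto
  show ?thesis
  proof (rule metrizable_from_countable_entourages[where E = "\<lambda>n. cnear (V n)"])
    show "t1_space ?X" using pseudo by (rule countable_pseudocharacter_imp_t1_space)
    show "cnear (V n) P P" if "P \<in> topspace ?X" for n P
      using V[of n] that cnear_refl unfolding good_def by simp
    show "cnear (V n) R P" if "cnear (V n) P R" for n P R
      using V[of n] that unfolding good_def by simp
    show "cnear (V n) P Z"
      if "cnear (V (Suc n)) P R" "cnear (V (Suc n)) R S" "cnear (V (Suc n)) S Z" for n P R S Z
      using V_finer[of n] that unfolding finer_def by meson
    show "\<exists>N. openin ?X N \<and> P \<in> N \<and> (\<forall>R\<in>N. cnear (V n) P R)" if "P \<in> topspace ?X" for n P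
      using V[of n] that cnear_nbhd unfolding good_def by simp
    show "\<exists>n. \<forall>R\<in>topspace ?X. cnear (V n) P R \<longrightarrow> R \<in> N" if "openin ?X N" "P \<in> N" for N P
    proof -
      obtain W where W: "gyr_nbhd W" "\<forall>R. cnear W P R \<longrightarrow> R \<in> N"
        using cnear_base[OF \<open>openin ?X N\<close> \<open>P \<in> N\<close>] by blast
      obtain n where n: "\<forall>P R. cnear (U n) P R \<longrightarrow> cnear W P R" using U_base W(1) by blast
      have "R \<in> N" if "cnear (V (Suc n)) P R" for R
        using V_finer[of n] n W(2) that unfolding finer_def by simp
      then show ?thesis by blast
    qed
  qed
qed

end

theorem theorem3p12:
  fixes G :: "('a, 'm) gyrostructure_scheme" and T :: "'a topology" and H :: "'a set"
  assumes "strongly_topological_gyrogroup G T"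
    and "closedin T H"
    and "strong_subgyrogroup G H"
    and "neutral_in G T H"
  shows "metrizable_space (coset_space G T H) \<longleftrightarrow>
    biradial_space (coset_space G T H) \<and> countable_pseudocharacter (coset_space G T H)"
proof
  assume metrizable: "metrizable_space (coset_space G T H)"
  have "closedin (coset_space G T H) {P}" if "P \<in> topspace (coset_space G T H)" for P
    using metrizable_imp_t1_space[OF metrizable] that by (simp add: closedin_t1_singleton)
  then have "countable_pseudocharacter (coset_space G T H)"
    using closed_imp_gdelta_in[OF metrizable] unfolding countable_pseudocharacter_def by blast
  then show "biradial_space (coset_space G T H) \<and> countable_pseudocharacter (coset_space G T H)"
    using metrizable_imp_biradial_space[OF metrizable] by blast
next
  interpret neutral_coset_space G T H
    by (intro neutral_coset_space.intro neutral_coset_space_axioms.intro assms)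
  assume "biradial_space (coset_space G T H) \<and> countable_pseudocharacter (coset_space G T H)"
  then show "metrizable_space (coset_space G T H)" using metrizable_coset_space by blast
qed

end
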